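(* Let $p\in(0,1)$, $q\in(0,\infty]$ and let $b$ be a slowly varying function. Then the associate space of $L^{p,q,b}$ is trivial: $(L^{p,q,b})'=\{0\}$.
   Context: $(R,\mu)$ is a $\sigma$-finite non-atomic measure space with $\mu(R)=\infty$; $M=M(R,\mu)$ is the set of extended complex-valued $\mu$-measurable functions on $R$ (identified when equal $\mu$-a.e.). For $f\in M$, $f^*(t)=\inf\{s\ge 0:\mu(\{|f|>s\})\le t\}$. Convention: $1/\infty=0$. A measurable $b:(0,\infty)\to(0,\infty)$ is slowly varying if for every $\varepsilon>0$ there are a non-decreasing function $b_\varepsilon$ and a non-increasing function $b_{-\varepsilon}$ with $t^\varepsilon b(t)\approx b_\varepsilon(t)$ and $t^{-\varepsilon}b(t)\approx b_{-\varepsilon}(t)$ on $(0,\infty)$, where $\approx$ denotes two-sided estimate up to positive finite multiplicative constants. For $f\in M$, $\lVert f\rVert_{p,q,b}=\lVert t^{1/p-1/q}b(t)f^*(t)\rVert_q$, where $\lVert\cdot\rVert_q$ is the Lebesgue $L^q$ (quasi)norm over $(0,\infty)$ in the variable $t$, and $L^{p,q,b}=\{f\in M:\lVert f\rVert_{p,q,b}<\infty\}$. The associate space of a space $X=\{f\in M:\lVert f\rVert_X<\infty\}$ is $X'=\{f\in M:\lVert f\rVert_{X'}<\infty\}$, where $\lVert f\rVert_{X'}=\sup\{\int_R|fg|\,d\mu: g\in M,\ \lVert g\rVert_X\le1\}$. *)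

theory Defs
  imports "HOL-Analysis.Analysis" "HOL-Probability.Essential_Supremum"
begin

definition atom :: "'a measure \<Rightarrow> 'a set \<Rightarrow> bool" where
  "atom M A \<longleftrightarrow> A \<in> sets M \<and> emeasure M A > 0 \<and>
     (\<forall>B\<in>sets M. B \<subseteq> A \<longrightarrow> emeasure M B = 0 \<or> emeasure M (A - B) = 0)"

definition nonatomic :: "'a measure \<Rightarrow> bool" where
  "nonatomic M \<longleftrightarrow> \<not> (\<exists>A. atom M A)"

text \<open>Extended complex numbers are the points \<open>Some z\<close> of the plane together with the point
  \<open>None\<close> at infinity; the topology is that of the one-point compactification.\<close>

type_synonym ecomplex = "complex option"

definition ecomplex_borel :: "ecomplex measure" where
  "ecomplex_borel =
     sigma UNIV {U. openin (Alexandroff_compactification (euclidean :: complex topology)) U}"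

fun emod :: "ecomplex \<Rightarrow> ennreal" where
  "emod (Some z) = ennreal (cmod z)"
| "emod None = \<infinity>"

text \<open>The usual measure-theoretic convention that zero times infinity is zero.\<close>

definition emult :: "ecomplex \<Rightarrow> ecomplex \<Rightarrow> ecomplex" where
  "emult x y =
     (case (x, y) of
        (Some z, Some w) \<Rightarrow> Some (z * w)
      | _ \<Rightarrow> if x = Some 0 \<or> y = Some 0 then Some 0 else None)"

text \<open>Functions are not replaced by their classes modulo equality almost everywhere. All norms
  below are invariant under this equality, so a set of classes is represented by its union; the
  zero space is represented by the set of all functions vanishing almost everywhere.\<close>

definition meas_fun :: "'a measure \<Rightarrow> ('a \<Rightarrow> ecomplex) set" where
  "meas_fun M = measurable M ecomplex_borel"

definition zero_space :: "'a measure \<Rightarrow> ('a \<Rightarrow> ecomplex) set" where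
  "zero_space M = {f \<in> meas_fun M. AE x in M. f x = Some 0}"

text \<open>The decreasing rearrangement; the infimum of the empty set is infinity.\<close>

definition rearr :: "'a measure \<Rightarrow> ('a \<Rightarrow> ecomplex) \<Rightarrow> real \<Rightarrow> ennreal" where
  "rearr M f t = Inf {ennreal s | s::real. 0 \<le> s \<and>
     emeasure M {x \<in> space M. emod (f x) > ennreal s} \<le> ennreal t}"

definition slowly_varying :: "(real \<Rightarrow> real) \<Rightarrow> bool" where
  "slowly_varying b \<longleftrightarrow>
     b \<in> borel_measurable (lebesgue_on {0<..}) \<and> (\<forall>t>0. b t > 0) \<and>
     (\<forall>\<epsilon>>0. \<exists>b1 b2.
        mono_on {0<..} b1 \<and> antimono_on {0<..} b2 \<and>
        (\<exists>c>0. \<exists>C>0. \<forall>t>0. c * b1 t \<le> t powr \<epsilon> * b t \<and> t powr \<epsilon> * b t \<le> C * b1 t) \<and>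
        (\<exists>c>0. \<exists>C>0. \<forall>t>0. c * b2 t \<le> t powr (-\<epsilon>) * b t \<and> t powr (-\<epsilon>) * b t \<le> C * b2 t))"

text \<open>Powers with positive real exponent.\<close>

definition epowr :: "ennreal \<Rightarrow> real \<Rightarrow> ennreal" where
  "epowr x r = (if x = \<infinity> then \<infinity> else ennreal (enn2real x powr r))"

definition Lq_norm :: "ennreal \<Rightarrow> (real \<Rightarrow> ennreal) \<Rightarrow> ennreal" where
  "Lq_norm q h =
     (if q = \<infinity> then esssup (lebesgue_on {0<..}) h
      else epowr (\<integral>\<^sup>+t. epowr (h t) (enn2real q) \<partial>lebesgue_on {0<..}) (1 / enn2real q))"

text \<open>Division in \<^typ>\<open>ennreal\<close> satisfies the convention \<open>1 / \<infinity> = 0\<close>.\<close>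

definition LK_norm ::
    "'a measure \<Rightarrow> ennreal \<Rightarrow> ennreal \<Rightarrow> (real \<Rightarrow> real) \<Rightarrow> ('a \<Rightarrow> ecomplex) \<Rightarrow> ennreal" where
  "LK_norm M p q b f =
     Lq_norm q (\<lambda>t. ennreal (t powr (enn2real (1 / p) - enn2real (1 / q)) * b t) * rearr M f t)"

definition space_of_norm ::
    "'a measure \<Rightarrow> (('a \<Rightarrow> ecomplex) \<Rightarrow> ennreal) \<Rightarrow> ('a \<Rightarrow> ecomplex) set" where
  "space_of_norm M N = {f \<in> meas_fun M. N f < \<infinity>}"

definition assoc_norm ::
    "'a measure \<Rightarrow> (('a \<Rightarrow> ecomplex) \<Rightarrow> ennreal) \<Rightarrow> ('a \<Rightarrow> ecomplex) \<Rightarrow> ennreal" where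
  "assoc_norm M N f =
     (SUP g \<in> {g \<in> meas_fun M. N g \<le> 1}. \<integral>\<^sup>+x. emod (emult (f x) (g x)) \<partial>M)"

text \<open>The associate space of \<open>space_of_norm M N\<close>.\<close>

definition assoc_space ::
    "'a measure \<Rightarrow> (('a \<Rightarrow> ecomplex) \<Rightarrow> ennreal) \<Rightarrow> ('a \<Rightarrow> ecomplex) set" where
  "assoc_space M N = space_of_norm M (assoc_norm M N)"

end

theory Submission
  imports Defs
begin

text \<open>If \<open>|f| > s > 0\<close> on a set of positive finite measure, non-atomicity provides subsets \<open>A\<close> of
  arbitrarily small measure \<open>a > 0\<close>. As \<open>b\<close> is slowly varying, \<open>b t \<le> K * t powr (- \<epsilon>)\<close> on \<open>(0,1]\<close>, so the norm
  of the indicator of \<open>A\<close> is at most a constant times \<open>a powr (1 / p - \<epsilon>)\<close>. With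
  \<open>\<epsilon> = (1 / p - 1) / 2 > 0\<close> this exponent is \<open>1 + \<epsilon>\<close>; testing \<open>f\<close> against the normalised indicator
  bounds its associate norm below by a constant times \<open>a powr (- \<epsilon>)\<close>, which is unbounded.\<close>

section \<open>Level sets, and rearrangements of scaled indicators\<close>

text \<open>The values of modulus above \<open>s\<close> form the complement of a compact disc
  together with \<open>None\<close>, a neighbourhood of infinity that is open in the
  compactification and hence a generator of \<open>ecomplex_borel\<close>.\<close>

lemma sets_emod_gt:
  assumes "f \<in> meas_fun M" "0 \<le> s"
  shows "{x \<in> space M. ennreal s < emod (f x)} \<in> sets M"
proof -
  define U where "U = insert None (Some ` (- cball (0::complex) s))"
  have "openin (Alexandroff_compactification (euclidean :: complex topology)) U"
    unfolding openin_Alexandroff_compactification U_def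
    by (intro disjI2 exI[of _ "cball 0 s"]) (auto simp: Compl_eq_Diff_UNIV)
  hence U: "U \<in> sets ecomplex_borel"
    unfolding ecomplex_borel_def by (auto intro: sigma_sets.Basic)
  have "emod y > ennreal s \<longleftrightarrow> y \<in> U" for y
    using assms(2) by (cases y) (auto simp: U_def ennreal_less_iff)
  hence "{x \<in> space M. ennreal s < emod (f x)} = f -` U \<inter> space M"
    by auto
  thus ?thesis
    using measurable_sets[OF _ U] assms(1) unfolding meas_fun_def by simp
qed

definition step_fun :: "'a set \<Rightarrow> real \<Rightarrow> 'a \<Rightarrow> ecomplex" where
  "step_fun A c x = (if x \<in> A then Some (of_real c) else Some 0)"

lemma step_fun_meas_fun: "A \<in> sets M \<Longrightarrow> step_fun A c \<in> meas_fun M"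
  unfolding meas_fun_def step_fun_def
  by (intro measurable_If_set) (auto simp: ecomplex_borel_def space_measure_of_conv)

text \<open>A level \<open>s\<close> below \<open>c\<close> is exceeded exactly on \<open>A\<close>,
  any other level nowhere, so the infimum depends only on whether \<open>t\<close> lies below the
  measure of \<open>A\<close>. Negative \<open>t\<close> fit the formula because
  \<open>ennreal t\<close> is then 0.\<close>

lemma rearr_step_fun:
  assumes "A \<in> sets M" "0 \<le> c"
  shows "rearr M (step_fun A c) t = (if ennreal t < emeasure M A then ennreal c else 0)"
proof -
  have S: "{x \<in> space M. ennreal s < emod (step_fun A c x)} = (if s < c then A else {})"
    if "0 \<le> s" for s
    using that assms sets.sets_into_space[OF assms(1)]
    by (auto simp: step_fun_def ennreal_less_iff)
  have "rearr M (step_fun A c) t =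
      Inf {ennreal s | s. 0 \<le> s \<and> emeasure M (if s < c then A else {}) \<le> ennreal t}"
    unfolding rearr_def by (rule arg_cong[of _ _ Inf]) (use S in auto)
  also have "\<dots> = (if ennreal t < emeasure M A then ennreal c else 0)"
  proof (cases "ennreal t < emeasure M A")
    case True
    hence "{ennreal s | s. 0 \<le> s \<and> emeasure M (if s < c then A else {}) \<le> ennreal t}
        = {ennreal s | s. c \<le> s}"
      using assms(2) by (auto simp: not_less leD)
    moreover have "Inf {ennreal s | s. c \<le> s} = ennreal c"
      by (intro antisym Inf_lower Inf_greatest) (auto simp: ennreal_leI)
    ultimately show ?thesis using True by simp
  next
    case False
    \<comment> \<open>Already the level 0 is admissible here, whether or not \<open>c\<close> is
      0.\<close>
    have "Inf {ennreal s | s. 0 \<le> s \<and> emeasure M (if s < c then A else {}) \<le> ennreal t} \<le> ennreal 0"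
      using False by (intro Inf_lower) (auto intro!: exI[of _ 0])
    thus ?thesis using False by simp
  qed
  finally show ?thesis .
qed

section \<open>Norm estimates for scaled indicators\<close>

text \<open>Up to constants \<open>t powr \<epsilon> * b t\<close> is non-decreasing, so on
  \<open>(0,1]\<close> it is controlled by its value at 1; this gives
  \<open>K = C * b1 1\<close>.\<close>

lemma slowly_varying_le_powr:
  assumes "slowly_varying b" "0 < \<epsilon>"
  obtains K where "0 < K" "\<And>t. 0 < t \<Longrightarrow> t \<le> 1 \<Longrightarrow> b t \<le> K * t powr (- \<epsilon>)"
proof -
  obtain b1 C where b1: "mono_on {0<..} b1" "0 < C"
      and le: "\<And>t. 0 < t \<Longrightarrow> t powr \<epsilon> * b t \<le> C * b1 t"
    using assms(1) spec[OF conjunct2[OF conjunct2[OF assms(1)[unfolded slowly_varying_def]]], of \<epsilon>]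
      assms(2) by blast
  have "b 1 > 0"
    using assms(1) unfolding slowly_varying_def by simp
  \<comment> \<open>At \<open>t = 1\<close> the power is 1, so \<open>C * b1 1\<close> dominates
    \<open>b 1\<close>.\<close>
  with le[of 1] have pos: "0 < C * b1 1"
    by simp
  have "b t \<le> C * b1 1 * t powr (- \<epsilon>)" if "0 < t" "t \<le> 1" for t
  proof -
    have "t powr \<epsilon> * b t \<le> C * b1 1"
      using le[OF that(1)] mono_onD[OF b1(1), of t 1] that b1(2)
      by (auto intro: order_trans mult_left_mono)
    thus ?thesis
      using that by (simp add: powr_minus field_simps)
  qed
  with pos show ?thesis using that by blast
qed

lemma nn_integral_powr_from_0:
  assumes "0 < \<beta>" "0 \<le> a"
  shows "(\<integral>\<^sup>+t. ennreal (t powr (\<beta> - 1)) * indicator {0..a} t \<partial>lebesgue) = ennreal (a powr \<beta> / \<beta>)"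
  using nn_integral_has_integral_lebesgue'[OF _ has_integral_powr_from_0[of "\<beta> - 1" a]] assms
  by (simp add: nn_integral_completion)

text \<open>Raising the majorant to the power \<open>q\<close> turns its exponent into
  \<open>\<alpha> * q - 1 > -1\<close>, which is integrable at 0; the integral over
  \<open>[0,a]\<close> is explicit.\<close>

lemma Lq_norm_truncated_power_le:
  assumes "q < \<infinity>" "0 < q" "0 < \<alpha>" "0 \<le> a" "0 \<le> L"
    and h: "\<And>t. 0 < t \<Longrightarrow> h t \<le> ennreal (L * t powr (\<alpha> - 1 / enn2real q)) * indicator {0..a} t"
  shows "Lq_norm q h \<le> ennreal (L * a powr \<alpha> * (1 / (\<alpha> * enn2real q)) powr (1 / enn2real q))"
proof -
  define r where "r = enn2real q"
  have r: "0 < r"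
    using assms(1,2) by (simp add: r_def enn2real_positive_iff)
  have "epowr (h t) r \<le> ennreal (L powr r) * (ennreal (t powr (\<alpha> * r - 1)) * indicator {0..a} t)"
    if t: "0 < t" for t
  proof (cases "t \<le> a")
    case True
    have le: "h t \<le> ennreal (L * t powr (\<alpha> - 1 / r))"
      using h[OF t] True t by (simp add: r_def)
    hence "enn2real (h t) \<le> L * t powr (\<alpha> - 1 / r)"
      using assms(5) by (simp add: enn2real_leI)
    hence "enn2real (h t) powr r \<le> (L * t powr (\<alpha> - 1 / r)) powr r"
      using r by (intro powr_mono2) auto
    also have "\<dots> = L powr r * t powr (\<alpha> * r - 1)"
      using r assms(5) by (simp add: powr_mult powr_powr algebra_simps)
    finally have "ennreal (enn2real (h t) powr r) \<le> ennreal (L powr r) * ennreal (t powr (\<alpha> * r - 1))"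
      by (simp add: ennreal_mult[symmetric] ennreal_leI)
    \<comment> \<open>\<open>epowr\<close> treats infinity separately, so finiteness is required
      before it becomes a real power.\<close>
    moreover have "h t \<noteq> \<infinity>"
      using le by (auto simp: top_unique)
    ultimately show ?thesis
      using True t by (simp add: epowr_def)
  next
    case False
    hence "h t = 0"
      using h[OF t] by simp
    thus ?thesis
      using False by (simp add: epowr_def)
  qed
  hence "(\<integral>\<^sup>+t. epowr (h t) r \<partial>lebesgue_on {0<..})
      \<le> (\<integral>\<^sup>+t. ennreal (L powr r) * (ennreal (t powr (\<alpha> * r - 1)) * indicator {0..a} t) \<partial>lebesgue_on {0<..})"
    by (intro nn_integral_mono) (simp add: space_restrict_space)
  also have "\<dots> \<le> (\<integral>\<^sup>+t. ennreal (L powr r) * (ennreal (t powr (\<alpha> * r - 1)) * indicator {0..a} t) \<partial>lebesgue)"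
    by (subst nn_integral_restrict_space) (auto intro!: nn_integral_mono simp: indicator_def)
  also have "\<dots> = ennreal (L powr r) * ennreal (a powr (\<alpha> * r) / (\<alpha> * r))"
    using r assms(3,4)
    by (subst nn_integral_cmult) (auto simp: nn_integral_powr_from_0 intro!: measurable_completion)
  also have "\<dots> = ennreal ((L * a powr \<alpha>) powr r * (1 / (\<alpha> * r)))"
    using r assms(3-5) by (simp add: ennreal_mult[symmetric] powr_mult powr_powr)
  finally have I: "(\<integral>\<^sup>+t. epowr (h t) r \<partial>lebesgue_on {0<..})
      \<le> ennreal ((L * a powr \<alpha>) powr r * (1 / (\<alpha> * r)))" (is "?I \<le> ennreal ?B") .
  have "?I \<noteq> \<infinity>"
    using I by (auto simp: top_unique)
  moreover have "enn2real ?I powr (1 / r) \<le> ?B powr (1 / r)"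
    using I r assms(3) by (intro powr_mono2 enn2real_leI) auto
  moreover have "?B powr (1 / r) = L * a powr \<alpha> * (1 / (\<alpha> * r)) powr (1 / r)"
    using r assms(3,5) by (simp add: powr_mult powr_powr powr_divide)
  ultimately show ?thesis
    using assms(1) by (simp add: Lq_norm_def epowr_def r_def ennreal_leI)
qed

text \<open>The constant \<open>K\<close> is fixed before \<open>A\<close>, \<open>a\<close> and
  \<open>c\<close>; this uniformity is what allows \<open>a\<close> to tend to 0 later.\<close>

lemma LK_norm_step_fun_le:
  assumes b: "slowly_varying b" and q: "0 < q" and \<epsilon>: "0 < \<epsilon>" "0 < enn2real (1 / p) - \<epsilon>"
  obtains K where "0 < K"
    "\<And>(M :: 'a measure) A a c. A \<in> sets M \<Longrightarrow> emeasure M A = ennreal a \<Longrightarrow> 0 \<le> a \<Longrightarrow> a \<le> 1 \<Longrightarrow> 0 \<le> c \<Longrightarrow>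
       LK_norm M p q b (step_fun A c) \<le> ennreal (K * c * a powr (enn2real (1 / p) - \<epsilon>))"
proof -
  define \<alpha> where "\<alpha> = enn2real (1 / p) - \<epsilon>"
  define r where "r = enn2real (1 / q)"
  obtain K where K: "0 < K" "\<And>t. 0 < t \<Longrightarrow> t \<le> 1 \<Longrightarrow> b t \<le> K * t powr (- \<epsilon>)"
    using slowly_varying_le_powr[OF b \<epsilon>(1)] by blast
  \<comment> \<open>This bound serves finite and infinite \<open>q\<close> alike. The rearrangement
    vanishes from \<open>a\<close> on, and \<open>a \<le> 1\<close> keeps the remaining
    \<open>t\<close> in the range where \<open>b\<close> is controlled.\<close>
  have pt: "ennreal (t powr (enn2real (1 / p) - r) * b t) * rearr M (step_fun A c) t
        \<le> ennreal (K * c * t powr (\<alpha> - r)) * indicator {0..a} t"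
    if "A \<in> sets M" "emeasure M A = ennreal a" "0 \<le> a" "a \<le> 1" "0 \<le> c" "0 < t"
    for M :: "'a measure" and A a c t
  proof (cases "t < a")
    case True
    have "t powr (enn2real (1 / p) - r) * b t * c
        \<le> t powr (enn2real (1 / p) - r) * (K * t powr (- \<epsilon>)) * c"
      using K(2)[of t] True that by (intro mult_right_mono mult_left_mono) auto
    also have "\<dots> = K * c * (t powr (enn2real (1 / p) - r) * t powr (- \<epsilon>))"
      by simp
    also have "t powr (enn2real (1 / p) - r) * t powr (- \<epsilon>) = t powr (\<alpha> - r)"
      by (simp add: \<alpha>_def powr_add[symmetric] algebra_simps)
    finally have "ennreal (t powr (enn2real (1 / p) - r) * b t * c) \<le> ennreal (K * c * t powr (\<alpha> - r))"
      by (rule ennreal_leI)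
    moreover have "0 < b t"
      using b that unfolding slowly_varying_def by simp
    ultimately show ?thesis
      using True that by (simp add: rearr_step_fun ennreal_less_iff ennreal_mult'')
  next
    case False
    thus ?thesis
      using that by (simp add: rearr_step_fun ennreal_less_iff)
  qed
  show ?thesis
  proof (cases "q = \<infinity>")
    case True
    hence r: "r = 0" by (simp add: r_def)
    have "LK_norm M p q b (step_fun A c) \<le> ennreal (K * c * a powr \<alpha>)"
      if A: "A \<in> sets M" "emeasure M A = ennreal a" "0 \<le> a" "a \<le> 1" "0 \<le> c"
      for M :: "'a measure" and A a c
    proof -
      \<comment> \<open>\<open>esssup\<close> is top on non-measurable functions, so a pointwise
        bound on the weighted rearrangement only helps once its measurability is known.\<close>
      have [measurable]: "b \<in> borel_measurable (lebesgue_on {0<..})"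
        using b unfolding slowly_varying_def by simp
      have rearr: "rearr M (step_fun A c) t = (if t < a then ennreal c else 0)" if "0 < t" for t
        using A that by (simp add: rearr_step_fun ennreal_less_iff)
      have id: "(\<lambda>t. t) \<in> borel_measurable (lebesgue_on {0<..})"
        by (rule measurable_restrict_space1) (simp add: measurable_completion)
      have "(\<lambda>t. ennreal (t powr (enn2real (1 / p) - r) * b t) * (if t < a then ennreal c else 0))
          \<in> borel_measurable (lebesgue_on {0<..})"
        using id by measurable
      hence "(\<lambda>t. ennreal (t powr (enn2real (1 / p) - r) * b t) * rearr M (step_fun A c) t)
          \<in> borel_measurable (lebesgue_on {0<..})"
        by (rule subst[OF measurable_cong, rotated]) (simp add: rearr space_restrict_space)
      moreover have "ennreal (t powr (enn2real (1 / p) - r) * b t) * rearr M (step_fun A c) t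
          \<le> ennreal (K * c * a powr \<alpha>)" if t: "0 < t" for t
      proof -
        have "t powr \<alpha> \<le> a powr \<alpha>" if "t \<le> a"
          using t that \<epsilon>(2) by (intro powr_mono2) (auto simp: \<alpha>_def)
        hence "ennreal (K * c * t powr (\<alpha> - r)) * indicator {0..a} t \<le> ennreal (K * c * a powr \<alpha>)"
          using K(1) A(5) by (auto simp: indicator_def r intro!: ennreal_leI mult_left_mono)
        with pt[OF A t] show ?thesis by (rule order_trans)
      qed
      ultimately show ?thesis
        using True unfolding LK_norm_def Lq_norm_def r_def[symmetric]
        by (auto intro!: esssup_I AE_I2 simp: space_restrict_space)
    qed
    thus ?thesis using that K(1) unfolding \<alpha>_def by blast
  next
    case False
    hence fin: "q < \<infinity>" by (simp add: less_top)
    have r: "r = 1 / enn2real q"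
      using q fin by (cases q) (auto simp: r_def divide_ennreal simp flip: ennreal_1)
    have pos: "0 < enn2real q"
      using q fin by (simp add: enn2real_positive_iff)
    have "LK_norm M p q b (step_fun A c)
        \<le> ennreal (K * (1 / (\<alpha> * enn2real q)) powr (1 / enn2real q) * c * a powr \<alpha>)"
      if A: "A \<in> sets M" "emeasure M A = ennreal a" "0 \<le> a" "a \<le> 1" "0 \<le> c"
      for M :: "'a measure" and A a c
    proof -
      have "LK_norm M p q b (step_fun A c)
          \<le> ennreal (K * c * a powr \<alpha> * (1 / (\<alpha> * enn2real q)) powr (1 / enn2real q))"
        unfolding LK_norm_def r_def[symmetric]
        by (intro Lq_norm_truncated_power_le fin q)
          (use pt[OF A] A K(1) \<epsilon>(2) in \<open>auto simp: r \<alpha>_def\<close>)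
      thus ?thesis by (simp add: mult_ac)
    qed
    moreover have "0 < K * (1 / (\<alpha> * enn2real q)) powr (1 / enn2real q)"
      using K(1) pos \<epsilon>(2) by (simp add: \<alpha>_def)
    ultimately show ?thesis using that unfolding \<alpha>_def by blast
  qed
qed

section \<open>Sets of small positive measure and level sets of nonzero functions\<close>

text \<open>Repeated halving: a set that is not an atom splits into two parts of positive measure,
  one of which carries at most half of the total.\<close>

lemma nonatomic_small_subset:
  assumes "nonatomic M" "E \<in> sets M" "0 < emeasure M E" "emeasure M E < \<infinity>"
  shows "\<exists>A\<in>sets M. A \<subseteq> E \<and> 0 < emeasure M A \<and> emeasure M A \<le> ennreal (measure M E / 2 ^ n)"
proof (induction n)
  case 0
  show ?case
    using assms by (intro bexI[of _ E]) (auto simp: emeasure_eq_ennreal_measure)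
next
  case (Suc n)
  then obtain A where A: "A \<in> sets M" "A \<subseteq> E" "0 < emeasure M A"
      "emeasure M A \<le> ennreal (measure M E / 2 ^ n)" by blast
  obtain B where B: "B \<in> sets M" "B \<subseteq> A" "emeasure M B \<noteq> 0" "emeasure M (A - B) \<noteq> 0"
    using assms(1) A unfolding nonatomic_def atom_def by blast
  have fin: "emeasure M X = ennreal (measure M X)" if "X \<subseteq> A" for X
    using A assms(2,4) that
    by (intro emeasure_eq_ennreal_measure) (metis emeasure_mono infinity_ennreal_def leD order_trans)
  have "emeasure M A = emeasure M B + emeasure M (A - B)"
    using plus_emeasure[of B M "A - B"] A(1) B(1,2) by (simp add: Un_absorb1)
  hence "measure M B + measure M (A - B) \<le> measure M E / 2 ^ n"
    using A(4) fin[of A] fin[of B] fin[of "A - B"] B(2) by (simp flip: ennreal_plus)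
  hence "measure M B \<le> measure M E / 2 ^ Suc n \<or> measure M (A - B) \<le> measure M E / 2 ^ Suc n"
    by simp linarith
  moreover have "A - B \<in> sets M" "A - B \<subseteq> E" "B \<subseteq> E" "A - B \<subseteq> A"
    using A B by auto
  ultimately show ?case
    using B fin[of B] fin[of "A - B"] by (metis ennreal_leI not_gr_zero)
qed

lemma not_zero_space_level_set:
  assumes "sigma_finite_measure M" "f \<in> meas_fun M" "f \<notin> zero_space M"
  obtains E s where "0 < s" "E \<in> sets M" "0 < emeasure M E" "emeasure M E < \<infinity>"
    "\<And>x. x \<in> E \<Longrightarrow> ennreal s < emod (f x)"
proof -
  obtain F where F: "range F \<subseteq> sets M" "(\<Union>i. F i) = space M" "\<And>i::nat. emeasure M (F i) \<noteq> \<infinity>"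
    using sigma_finite_measure.sigma_finite[OF assms(1)] by blast
  \<comment> \<open>The levels \<open>1 / (n + 1)\<close> exhaust the set where \<open>f\<close> is
    nonzero, and intersecting with \<open>F i\<close> makes each piece of finite measure. If all
    these countably many pieces were null, \<open>f\<close> would vanish almost everywhere.\<close>
  define G where "G n i = {x \<in> space M. ennreal (1 / real (Suc n)) < emod (f x)} \<inter> F i" for n i
  have G: "G n i \<in> sets M" for n i
    unfolding G_def using F(1) by (intro sets.Int sets_emod_gt[OF assms(2)]) auto
  have "\<exists>n i. emeasure M (G n i) \<noteq> 0"
  proof (rule ccontr)
    assume "\<not> ?thesis"
    hence null: "(\<Union>n. \<Union>i. G n i) \<in> null_sets M"
      using G by (intro null_sets_UN) (auto simp: null_sets_def)
    have "x \<in> (\<Union>n. \<Union>i. G n i)" if "x \<in> space M" "f x \<noteq> Some 0" for x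
    proof -
      have "\<exists>n. ennreal (1 / real (Suc n)) < emod (f x)"
      proof (cases "f x")
        case (Some z)
        with that have "0 < cmod z" by simp
        then obtain n where "1 / real (Suc n) < cmod z"
          using nat_approx_posE by blast
        thus ?thesis using Some by (auto simp: ennreal_less_iff intro!: exI[of _ n])
      qed simp
      thus ?thesis using that F(2) by (auto simp: G_def)
    qed
    hence "AE x in M. f x = Some 0"
      by (intro AE_I'[OF null]) auto
    thus False using assms(2,3) by (simp add: zero_space_def)
  qed
  then obtain n i where ni: "emeasure M (G n i) \<noteq> 0" by blast
  have "emeasure M (G n i) \<le> emeasure M (F i)"
    using F(1) by (intro emeasure_mono) (auto simp: G_def)
  hence "emeasure M (G n i) < \<infinity>"
    using F(3)[of i] by (simp add: less_top top_unique)
  with ni show ?thesis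
    by (intro that[of "1 / real (Suc n)" "G n i"]) (use G[of n i] in \<open>auto simp: G_def zero_less_iff_neq_zero\<close>)
qed

section \<open>Testing against scaled indicators, and the conclusion\<close>

text \<open>The integrand is at least \<open>s * c\<close> on \<open>A\<close>. Where
  \<open>f\<close> is \<open>None\<close>, \<open>c > 0\<close> makes the product
  \<open>None\<close> rather than 0.\<close>

lemma nn_integral_emult_step_fun_ge:
  assumes "A \<in> sets M" "0 < c" "0 \<le> s" "\<And>x. x \<in> A \<Longrightarrow> ennreal s < emod (f x)"
  shows "ennreal (s * c) * emeasure M A \<le> (\<integral>\<^sup>+x. emod (emult (f x) (step_fun A c x)) \<partial>M)"
proof -
  have "ennreal (s * c) * indicator A x \<le> emod (emult (f x) (step_fun A c x))" for x
    using assms(2,3) assms(4)[of x]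
    by (cases "f x") (auto simp: emult_def step_fun_def norm_mult ennreal_less_iff indicator_def
        intro!: ennreal_leI mult_right_mono)
  hence "(\<integral>\<^sup>+x. ennreal (s * c) * indicator A x \<partial>M) \<le> (\<integral>\<^sup>+x. emod (emult (f x) (step_fun A c x)) \<partial>M)"
    by (intro nn_integral_mono)
  thus ?thesis using assms(1) by (simp add: nn_integral_cmult_indicator)
qed

text \<open>By the convention that zero times infinity is zero, the product vanishes wherever
  \<open>f\<close> does, even at points where \<open>g\<close> is \<open>None\<close>.\<close>

lemma zero_space_subset_assoc_space: "zero_space M \<subseteq> assoc_space M N"
proof
  fix f assume f: "f \<in> zero_space M"
  have "(\<integral>\<^sup>+x. emod (emult (f x) (g x)) \<partial>M) = 0" for g
  proof -
    have "AE x in M. emod (emult (f x) (g x)) = 0"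
      using f unfolding zero_space_def by (auto simp: emult_def split: option.splits elim!: eventually_mono)
    thus ?thesis by (subst nn_integral_cong_AE[of _ "\<lambda>_. 0"]) auto
  qed
  hence "assoc_norm M N f \<le> 0"
    unfolding assoc_norm_def by (intro SUP_least) simp
  thus "f \<in> assoc_space M N"
    using f unfolding assoc_space_def space_of_norm_def zero_space_def by simp
qed

theorem proposition3p27:
  fixes M :: "'a measure" and p q :: ennreal and b :: "real \<Rightarrow> real"
  assumes "sigma_finite_measure M" and "nonatomic M" and "emeasure M (space M) = \<infinity>"
    and "0 < p" and "p < 1" and "0 < q" and "slowly_varying b"
  shows "assoc_space M (LK_norm M p q b) = zero_space M"
proof (intro antisym zero_space_subset_assoc_space subsetI, rule ccontr)
  fix f assume f: "f \<in> assoc_space M (LK_norm M p q b)" "f \<notin> zero_space M"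
  hence meas: "f \<in> meas_fun M" and fin: "assoc_norm M (LK_norm M p q b) f < \<infinity>"
    by (auto simp: assoc_space_def space_of_norm_def)
  define P where "P = enn2real (1 / p)"
  have P: "1 < P"
  proof (cases p)
    case (real r)
    with assms(4,5) have "0 < r" "r < 1" by (auto simp: ennreal_less_iff simp flip: ennreal_1)
    thus ?thesis using real by (simp add: P_def divide_ennreal flip: ennreal_1)
  qed (use assms(5) in auto)
  define \<epsilon> where "\<epsilon> = (P - 1) / 2"
  have \<epsilon>: "0 < \<epsilon>" "P - \<epsilon> = 1 + \<epsilon>" "0 < P - \<epsilon>"
    using P by (auto simp: \<epsilon>_def field_simps)
  obtain K where K: "0 < K"
    "\<And>A a c. A \<in> sets M \<Longrightarrow> emeasure M A = ennreal a \<Longrightarrow> 0 \<le> a \<Longrightarrow> a \<le> 1 \<Longrightarrow> 0 \<le> c \<Longrightarrow>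
       LK_norm M p q b (step_fun A c) \<le> ennreal (K * c * a powr (1 + \<epsilon>))"
    using LK_norm_step_fun_le[OF assms(7,6) \<epsilon>(1) \<epsilon>(3)[unfolded P_def], where ?'a = 'a] \<epsilon>(2)
    unfolding P_def by metis
  obtain E s where E: "0 < s" "E \<in> sets M" "0 < emeasure M E" "emeasure M E < \<infinity>"
    "\<And>x. x \<in> E \<Longrightarrow> ennreal s < emod (f x)"
    using not_zero_space_level_set[OF assms(1) meas f(2)] by metis
  define T where "T = enn2real (assoc_norm M (LK_norm M p q b) f)"
  have T: "0 \<le> T" "assoc_norm M (LK_norm M p q b) f = ennreal T"
    using fin by (auto simp: T_def)
  have lower: "s \<le> T * K * a powr \<epsilon>"
    if A: "A \<in> sets M" "A \<subseteq> E" "emeasure M A = ennreal a" "0 < a" "a \<le> 1" for A a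
  proof -
    \<comment> \<open>This normalisation turns the bound in \<open>K(2)\<close> into 1, so
      \<open>step_fun A c\<close> is admissible in the supremum defining
      \<open>assoc_norm\<close>.\<close>
    define c where "c = a powr (- (1 + \<epsilon>)) / K"
    have c: "0 < c" using that K(1) by (simp add: c_def)
    have "K * c * a powr (1 + \<epsilon>) = 1"
      using K(1) A by (simp add: c_def powr_add[symmetric])
    hence "LK_norm M p q b (step_fun A c) \<le> 1"
      using K(2)[OF A(1,3), of c] A c by simp
    hence "(\<integral>\<^sup>+x. emod (emult (f x) (step_fun A c x)) \<partial>M) \<le> ennreal T"
      unfolding T(2)[symmetric] assoc_norm_def using step_fun_meas_fun[OF A(1)]
      by (intro SUP_upper) auto
    moreover have "ennreal (s * c) * emeasure M A \<le> (\<integral>\<^sup>+x. emod (emult (f x) (step_fun A c x)) \<partial>M)"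
      using A E c by (intro nn_integral_emult_step_fun_ge) auto
    ultimately have "ennreal (s * c * a) \<le> ennreal T"
      using A c E(1) by (simp add: ennreal_mult'')
    hence "s * c * a \<le> T"
      using T(1) by simp
    moreover have "c * a = a powr (- \<epsilon>) / K"
      using A powr_add[of a "- (1 + \<epsilon>)" 1] by (simp add: c_def mult.commute)
    ultimately have "s * (a powr (- \<epsilon>) / K) \<le> T"
      by (simp add: mult.assoc)
    thus ?thesis
      using A K(1) by (simp add: powr_minus field_simps)
  qed
  \<comment> \<open>For \<open>a \<le> d\<close> this gives \<open>T * K * a powr \<epsilon> \<le> T
    * K * s / (2 * (T * K + 1)) < s\<close>, against \<open>lower\<close>. The summand 1 keeps the
    denominator positive when \<open>T = 0\<close>, and the minimum ensures
    \<open>a \<le> 1\<close>.\<close>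
  define d where "d = min 1 ((s / (2 * (T * K + 1))) powr (1 / \<epsilon>))"
  have TK: "0 \<le> T * K" using T(1) K(1) by simp
  have d: "0 < d" "d \<le> 1" using E(1) TK by (auto simp: d_def)
  obtain n :: nat where n: "measure M E / 2 ^ n \<le> d"
  proof -
    obtain n where "measure M E / d < 2 ^ n"
      using real_arch_pow[of 2 "measure M E / d"] by auto
    thus ?thesis using d by (intro that[of n]) (simp add: field_simps)
  qed
  obtain A where A: "A \<in> sets M" "A \<subseteq> E" "0 < emeasure M A"
      "emeasure M A \<le> ennreal (measure M E / 2 ^ n)"
    using nonatomic_small_subset[OF assms(2) E(2-4)] by blast
  define a where "a = measure M A"
  have a: "emeasure M A = ennreal a"
    unfolding a_def using A(4) by (intro emeasure_eq_ennreal_measure) (auto simp: top_unique)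
  have "0 < a" using A(3) a by simp
  have "a \<le> d" using A(4) a n by simp
  have "a powr \<epsilon> \<le> d powr \<epsilon>"
    using \<open>0 < a\<close> \<open>a \<le> d\<close> \<epsilon>(1) by (intro powr_mono2) auto
  also have "\<dots> \<le> ((s / (2 * (T * K + 1))) powr (1 / \<epsilon>)) powr \<epsilon>"
    using d \<epsilon>(1) by (intro powr_mono2) (auto simp: d_def)
  also have "\<dots> = s / (2 * (T * K + 1))"
    using \<epsilon>(1) E(1) TK by (simp add: powr_powr)
  finally have "T * K * a powr \<epsilon> \<le> T * K * (s / (2 * (T * K + 1)))"
    using TK by (intro mult_left_mono)
  also have "\<dots> < s"
  proof -
    have "0 \<le> T * K * s" using TK E(1) by simp
    thus ?thesis using TK E(1) by (simp add: field_simps)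
  qed
  finally show False
    using lower[OF A(1,2) a \<open>0 < a\<close>] \<open>a \<le> d\<close> d by linarith
qed

end
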